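(* Let $\alpha\ge0$ and let $d\ge1$ be an integer. Let $\{\widehat H_n\}_{n\ge0}$ be the symmetric $d$-orthogonal Appell polynomials, that is, the monic polynomial sequence defined by $\widehat H_n(x)=x^n$ for $n=0,1,\dots,d$ and $\widehat H_{n+d+1}(x)=x\widehat H_{n+d}(x)-(d+1)^{-1}\binom{n+d}{d}\widehat H_n(x)$ for $n\ge0$. The polynomial sequence $\{S_n\}_{n\ge0}$ corresponding to its $KL_\alpha$-transform, $S_n\left(\frac{\tau^2}{4};\alpha\right)=KL_\alpha[\widehat H_n](\tau)$, is a $(2d+2)$-orthogonal polynomial sequence fulfilling $$\begin{aligned}S_{n+1}\left(\tfrac{\tau^2}{4};\alpha\right)=&\left(\tfrac{\tau^2}{4}+\alpha^2+(n+1)(n+1+2\alpha)\right)S_n\left(\tfrac{\tau^2}{4};\alpha\right)-(d+1)^{-1}\binom nd S_{n-d}\left(\tfrac{\tau^2}{4};\alpha\right)\\&+(2n+2\alpha+1-d)\binom{n}{d+1}S_{n-d-1}\left(\tfrac{\tau^2}{4};\alpha\right)\\&+n(n-1)(d+1)^{-1}\binom{n-d-2}{d}S_{n-2d-2}\left(\tfrac{\tau^2}{4};\alpha\right),\end{aligned}$$ $$S_n\left(\tfrac{\tau^2}{4};\alpha\right)=\left((\alpha+1)-\tfrac{i\tau}{2}\right)_n\left((\alpha+1)+\tfrac{i\tau}{2}\right)_n,\quad n=0,1,\dots,2d+1.$$ Moreover, $$\delta_i S_n\left(\tfrac{\tau^2}{4};\alpha\right)=n\,S_{n-1}\left(\tfrac{\tau^2}{4};\alpha+\tfrac12\right),\quad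 n\in\mathbb{N}_0,$$ where $\delta_\omega$ denotes the central difference operator $(\delta_\omega f)(\tau)=\dfrac{f(\tau+\omega)-f(\tau-\omega)}{2\omega\tau}$, $\omega\neq0$, acting with respect to $\tau$ (here $\omega=i$).
   Context: $\mathbb{N}_0=\{0,1,2,\dots\}$; $(x)_n=\prod_{\sigma=0}^{n-1}(x+\sigma)$, $(x)_0=1$; any term containing $S_{-k}$ with $k\ge 1$ is interpreted as $0$. For $\alpha\ge 0$ and $\tau>0$, $$KL_\alpha[f](\tau)=2\left|\Gamma\left(\alpha+1+\tfrac{i\tau}{2}\right)\right|^{-2}\int_0^\infty x^\alpha K_{i\tau}(2\sqrt{x})f(x)\,dx,$$ where $K_\nu$ is the modified Bessel (Macdonald) function. For polynomial $f$ the result is a polynomial in $\tau^2/4$ of the same degree (and is so regarded for complex $\tau$), with $KL_\alpha[x^n](\tau)=\left(\alpha+1-\frac{i\tau}{2}\right)_n\left(\alpha+1+\frac{i\tau}{2}\right)_n$. A monic polynomial sequence $\{P_n\}$ is Appell if $P_{n+1}'=(n+1)P_n$ for all $n\ge0$. For a positive integer $m$, a polynomial sequence $\{P_n\}_{n\ge0}$ with $\deg P_n=n$ is $m$-orthogonal if there are linear functionals $w_0,\dots,w_{m-1}$ on the space of complex polynomials such that for each $k=0,\dots,m-1$: $\langle w_k,x^jP_n\rangle=0$ for $n\ge jm+k+1$, $j\ge0$, and $\langle w_k,x^jP_{jm+k}\rangle\ne0$ for $j\ge0$.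
   Formalization: As printed this is false. Proved instead: the product formula for n=0,…,d only (S_{d+1} is the product minus 1/(d+1)); S_{n-2d-2} has coefficient (n-d-1)C(n,d+1)C(n-d-2,d)/(d+1) in place of n(n-1)C(n-d-2,d)/(d+1); δ_i S_n has factor n/2, not n (δ_i S_1=1/2). *)

theory Defs
  imports "HOL-Analysis.Analysis" "HOL-Computational_Algebra.Polynomial"
begin

(* K_nu(x) for x > 0 and arbitrary complex order, by its classical integral over cosh;
   for nu = i tau it is the Fourier cosine integral of exp (-x cosh t). *)
definition macdonald_K :: "complex \<Rightarrow> real \<Rightarrow> complex" where
  "macdonald_K \<nu> x =
     (LINT t:{0..}|lborel. complex_of_real (exp (- x * cosh t)) * cosh (\<nu> * complex_of_real t))"

definition KL :: "real \<Rightarrow> (real \<Rightarrow> complex) \<Rightarrow> real \<Rightarrow> complex" where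
  "KL \<alpha> f \<tau> =
     2 * inverse (complex_of_real ((cmod (Gamma (complex_of_real \<alpha> + 1 + \<i> * complex_of_real \<tau> / 2)))\<^sup>2)) *
     (LINT x:{0<..}|lborel.
        complex_of_real (x powr \<alpha>) * macdonald_K (\<i> * complex_of_real \<tau>) (2 * sqrt x) * f x)"

(* The transform of a polynomial, as a polynomial in the variable tau^2 / 4. The defining
   equation is required for tau > 0 only (infinitely many points, so the polynomial is
   unique); evaluating it elsewhere gives the extension to complex tau. *)
definition KL_poly :: "real \<Rightarrow> complex poly \<Rightarrow> complex poly" where
  "KL_poly \<alpha> p = (THE q. \<forall>\<tau>::real. \<tau> > 0 \<longrightarrow>
     poly q (complex_of_real (\<tau>\<^sup>2 / 4)) = KL \<alpha> (\<lambda>x. poly p (complex_of_real x)) \<tau>)"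

fun H_hat :: "nat \<Rightarrow> nat \<Rightarrow> complex poly" where
  "H_hat d n =
     (if n \<le> d then monom 1 n
      else [:0, 1:] * H_hat d (n - 1)
           - smult (inverse (of_nat (d + 1)) * of_nat ((n - 1) choose d)) (H_hat d (n - d - 1)))"

declare H_hat.simps [simp del]

lemma H_hat_initial: "n \<le> d \<Longrightarrow> H_hat d n = monom 1 n"
  by (simp add: H_hat.simps)

lemma H_hat_rec:
  "H_hat d (n + d + 1) =
     [:0, 1:] * H_hat d (n + d)
     - smult (inverse (of_nat (d + 1)) * of_nat ((n + d) choose d)) (H_hat d n)"
  by (subst H_hat.simps) simp

(* Integer index, so that S_{-k} = 0 for k >= 1 and no index is truncated at 0. *)
definition S_KL :: "nat \<Rightarrow> real \<Rightarrow> int \<Rightarrow> complex poly" where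
  "S_KL d \<alpha> k = (if k < 0 then 0 else KL_poly \<alpha> (H_hat d (nat k)))"

(* Functionals are complex-linear, hence the explicit scalar multiplications. *)
definition m_orthogonal :: "nat \<Rightarrow> (nat \<Rightarrow> complex poly) \<Rightarrow> bool" where
  "m_orthogonal m P \<longleftrightarrow>
     m > 0 \<and> (\<forall>n. P n \<noteq> 0 \<and> degree (P n) = n) \<and>
     (\<exists>w :: nat \<Rightarrow> complex poly \<Rightarrow> complex. \<forall>k<m.
        Vector_Spaces.linear smult (*) (w k) \<and>
        (\<forall>j n. n \<ge> j * m + k + 1 \<longrightarrow> w k (monom 1 j * P n) = 0) \<and>
        (\<forall>j. w k (monom 1 j * P (j * m + k)) \<noteq> 0))"

definition central_diff :: "complex \<Rightarrow> (complex \<Rightarrow> complex) \<Rightarrow> complex \<Rightarrow> complex" where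
  "central_diff \<omega> f \<tau> = (f (\<tau> + \<omega>) - f (\<tau> - \<omega>)) / (2 * \<omega> * \<tau>)"

(* Three formulas for S_n are forced by these definitions to differ from the ones printed in the
   literature:
     - the product formula holds for n <= d only: H_{d+1} = x^{d+1} - 1/(d+1), so
       S_{d+1} is the product minus 1/(d+1);
     - the coefficient of S_{n-2d-2} is (n-d-1) (n choose d+1) (n-d-2 choose d) / (d+1),
       where n (n-1) is printed in place of (n-d-1) (n choose d+1);
     - with the divisor 2 omega tau, the central difference of S_n has the factor n/2, not n:
       S_1 = tau^2/4 + (alpha+1)^2 has difference 1/2. *)

end

theory Submission
  imports Defs
begin

text \<open>
  In logarithmic coordinates the product of the Euler integrals for \<open>\<Gamma>(a)\<close> and \<open>\<Gamma>(b)\<close> is the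
  integral of \<open>exp (a v + b w - e\<^sup>v - e\<^sup>w)\<close> over the plane. The rotation \<open>v = y + t\<close>, \<open>w = y - t\<close> turns
  the inner integral into a Macdonald function, which gives the Mellin transform of
  \<open>K\<^bsub>i\<tau>\<^esub>(2\<surd>x)\<close> and hence \<open>KL\<^sub>\<alpha>[x\<^sup>n] = B\<^sub>n\<close> with \<open>B\<^sub>n(y) = \<Prod>\<^bsub>k<n\<^esub> (y + (\<alpha> + 1 + k)\<^sup>2)\<close>, \<open>y = \<tau>\<^sup>2/4\<close>.
  So the transform is the linear map \<open>L\<close> with \<open>x\<^sup>n \<mapsto> B\<^sub>n\<close>, and \<open>B\<^bsub>n+1\<^esub> = (y + (\<alpha> + 1 + n)\<^sup>2) B\<^sub>n\<close> reads
  \<open>L(x p) = y L(p) + L((\<alpha> + 1 + x d/dx)\<^sup>2 p)\<close>. The Appell property and the recurrence express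
  \<open>x H\<^sub>n'\<close> by \<open>H\<^sub>n\<close> and \<open>H\<^bsub>n-d-1\<^esub>\<close>, which yields the recurrence for \<open>S\<^sub>n = L(H\<^sub>n)\<close>. Its lowest
  coefficient, that of \<open>S\<^bsub>n-2d-2\<^esub>\<close>, does not vanish for \<open>n \<ge> 2d + 2\<close>, so the first \<open>2d + 2\<close>
  functionals of the basis dual to \<open>S\<^sub>n\<close> witness the orthogonality.
  The difference formula is \<open>\<delta>\<^sub>i L\<^sub>\<alpha>(p) = L\<^bsub>\<alpha>+1/2\<^esub>(p') / 2\<close>, checked on monomials, at the Appell \<open>p = H\<^sub>n\<close>.
\<close>

subsection \<open>The transform of a monomial\<close>

text \<open>\<open>exp\<close> maps the line bijectively onto the positive reals and is its own
  derivative. Stating both sides by \<open>has_bochner_integral\<close> transfers integrability and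
  value together.\<close>

lemma real_substitution_exp:
  fixes f :: "real \<Rightarrow> real"
  assumes [measurable]: "f \<in> borel_measurable borel"
  shows "has_bochner_integral lborel (\<lambda>y. exp y * f (exp y)) b \<longleftrightarrow>
         has_bochner_integral lborel (\<lambda>x. indicator {0<..} x * f x) b"
proof -
  have im: "exp ` (UNIV :: real set) = {0<..}"
    by (auto simp: image_iff) (metis exp_ln)
  \<comment> \<open>The change of variables speaks of the completed Lebesgue measure; for Borel
    functions this agrees with \<open>lborel\<close>.\<close>
  have L: "g absolutely_integrable_on S \<and> integral S g = b \<longleftrightarrow>
      has_bochner_integral lborel (\<lambda>x. indicator S x * g x) b"
    if [measurable]: "g \<in> borel_measurable borel" "S \<in> sets borel" for g :: "real \<Rightarrow> real" and S
  proof -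
    have "(\<lambda>x. indicator S x *\<^sub>R g x) \<in> borel_measurable lborel" by measurable
    then have "integrable lebesgue (\<lambda>x. indicator S x *\<^sub>R g x) \<longleftrightarrow> integrable lborel (\<lambda>x. indicator S x *\<^sub>R g x)"
      by (rule integrable_completion)
    moreover have "integral\<^sup>L lebesgue (\<lambda>x. indicator S x *\<^sub>R g x) = integral\<^sup>L lborel (\<lambda>x. indicator S x *\<^sub>R g x)"
      by (rule integral_completion) measurable
    moreover have "integral S g = integral\<^sup>L lebesgue (\<lambda>x. indicator S x *\<^sub>R g x)" if "g absolutely_integrable_on S"
      using set_lebesgue_integral_eq_integral(2)[OF that] by (simp add: set_lebesgue_integral_def)
    ultimately show ?thesis
      by (auto simp: has_bochner_integral_iff set_integrable_def)
  qed
  have "(\<lambda>x. \<bar>exp x\<bar> * f (exp x)) absolutely_integrable_on UNIV \<and>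
           integral UNIV (\<lambda>x. \<bar>exp x\<bar> * f (exp x)) = b
     \<longleftrightarrow> f absolutely_integrable_on (exp ` UNIV) \<and> integral (exp ` UNIV) f = b"
    by (rule has_absolute_integral_change_of_variables_1')
       (auto intro!: derivative_eq_intros inj_onI)
  then show ?thesis
    unfolding im by (subst (asm) (1 2) L) simp_all
qed

lemma has_bochner_integral_complex_iff:
  fixes f :: "'a \<Rightarrow> complex"
  shows "has_bochner_integral M f b \<longleftrightarrow>
    has_bochner_integral M (\<lambda>x. Re (f x)) (Re b) \<and> has_bochner_integral M (\<lambda>x. Im (f x)) (Im b)"
proof
  assume "has_bochner_integral M (\<lambda>x. Re (f x)) (Re b) \<and> has_bochner_integral M (\<lambda>x. Im (f x)) (Im b)"
  then have "has_bochner_integral M (\<lambda>x. of_real (Re (f x)) + \<i> * of_real (Im (f x))) (of_real (Re b) + \<i> * of_real (Im b))"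
    by (intro has_bochner_integral_add has_bochner_integral_mult_right has_bochner_integral_of_real) auto
  then show "has_bochner_integral M f b"
    by (simp flip: complex_eq)
qed (auto intro: has_bochner_integral_bounded_linear[OF bounded_linear_Re]
       has_bochner_integral_bounded_linear[OF bounded_linear_Im])

lemma complex_substitution_exp:
  fixes f :: "real \<Rightarrow> complex"
  assumes [measurable]: "f \<in> borel_measurable borel"
  shows "has_bochner_integral lborel (\<lambda>y. of_real (exp y) * f (exp y)) b \<longleftrightarrow>
         has_bochner_integral lborel (\<lambda>x. indicator {0<..} x *\<^sub>R f x) b"
proof -
  have "(\<lambda>x. Re (f x)) \<in> borel_measurable borel" "(\<lambda>x. Im (f x)) \<in> borel_measurable borel"
    by measurable
  from real_substitution_exp[OF this(1), of "Re b"] real_substitution_exp[OF this(2), of "Im b"]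
  show ?thesis
    by (subst (1 2) has_bochner_integral_complex_iff) simp
qed

text \<open>The substitution \<open>t = exp v\<close> in Euler's integral absorbs
  \<open>dt = exp v dv\<close> into the power, raising the exponent \<open>a - 1\<close> to
  \<open>a\<close>.\<close>

lemma Gamma_integral_exp:
  assumes "Re a > 0"
  shows "has_bochner_integral lborel (\<lambda>v. exp (a * complex_of_real v - of_real (exp v))) (Gamma a)"
proof -
  \<comment> \<open>Euler's integrand on the positive axis, written with the real logarithm so that
    Borel measurability is immediate.\<close>
  define f where "f t = (if t \<le> 0 then 0 else exp ((a - 1) * of_real (ln t)) / of_real (exp t))" for t :: real
  let ?g = "\<lambda>t. complex_of_real t powr (a - 1) / of_real (exp t)"
  have f_meas [measurable]: "f \<in> borel_measurable borel"
    unfolding f_def by measurable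
  have eq: "indicator {0<..} x *\<^sub>R ?g x = indicator {0<..} x *\<^sub>R f x" for x
    by (auto simp: f_def indicator_def powr_def Ln_of_real)
  have "?g absolutely_integrable_on {0<..}"
    by (rule absolutely_integrable_Gamma_integral'[OF assms])
  then have "integrable lebesgue (\<lambda>x. indicator {0<..} x *\<^sub>R f x)"
    unfolding set_integrable_def eq .
  moreover have "(LINT x|lebesgue. indicator {0<..} x *\<^sub>R f x) = Gamma a"
    using set_lebesgue_integral_eq_integral(2)[OF \<open>?g absolutely_integrable_on _\<close>]
      Gamma_integral_complex'[OF assms]
    unfolding set_lebesgue_integral_def eq by (simp add: integral_unique)
  ultimately have "has_bochner_integral lborel (\<lambda>x. indicator {0<..} x *\<^sub>R f x) (Gamma a)"
    by (simp add: has_bochner_integral_iff integrable_completion integral_completion)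
  then have "has_bochner_integral lborel (\<lambda>y. of_real (exp y) * f (exp y)) (Gamma a)"
    by (subst complex_substitution_exp) auto
  also have "(\<lambda>y. of_real (exp y) * f (exp y)) = (\<lambda>v. exp (a * of_real v - of_real (exp v)))"
    by (auto simp: f_def fun_eq_iff exp_of_real[symmetric] exp_diff exp_add algebra_simps)
  finally show ?thesis .
qed

text \<open>The rotation has Jacobian 2 in absolute value, whence the factor 1/2. It is carried out
  as \<open>w = 2 y - v\<close> for fixed \<open>v\<close>, then Fubini, then the translation
  \<open>v = y + t\<close>. Fubini yields integrable sections for almost every \<open>y\<close>
  only.\<close>

lemma integral_product_rotated:
  fixes f g :: "real \<Rightarrow> complex"
  assumes f: "has_bochner_integral lborel f A" and g: "has_bochner_integral lborel g B"
  shows "has_bochner_integral lborel (\<lambda>y. LINT t|lborel. f (y + t) * g (y - t)) (A * B / 2)"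
    and "AE y in lborel. integrable lborel (\<lambda>t. f (y + t) * g (y - t))"
proof -
  have [measurable]: "f \<in> borel_measurable borel" "g \<in> borel_measurable borel"
    using f g by (auto simp: has_bochner_integral_iff dest: borel_measurable_integrable)
  let ?h = "\<lambda>v y. f v * g (2 * y - v)"
  have g2: "has_bochner_integral lborel (\<lambda>y. g (2 * y - v)) (B / 2)" for v
    using g lborel_integrable_real_affine_iff[of 2 g "- v"] lborel_integral_real_affine[of 2 g "- v"]
    by (auto simp: has_bochner_integral_iff scaleR_conv_of_real mult.commute)
  have ng: "(LINT y|lborel. norm (g (2 * y - v))) = (LINT y|lborel. norm (g y)) / 2" for v
    using lborel_integral_real_affine[of 2 "\<lambda>y. norm (g y)" "- v"] by simp
  have int: "integrable (lborel \<Otimes>\<^sub>M lborel) (case_prod ?h)"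
  proof (rule lborel_pair.Fubini_integrable)
    show "integrable lborel (\<lambda>v. LINT y|lborel. norm (case (v, y) of (v, y) \<Rightarrow> ?h v y))"
      using f by (simp add: norm_mult ng has_bochner_integral_iff)
    show "AE v in lborel. integrable lborel (\<lambda>y. case (v, y) of (v, y) \<Rightarrow> ?h v y)"
      using g2 by (auto simp: has_bochner_integral_iff)
  qed measurable
  have sh: "f (y + 1 * t) * g (2 * y - (y + 1 * t)) = f (y + t) * g (y - t)" for y t
    by (simp add: algebra_simps)
  have eq1: "(LINT v|lborel. ?h v y) = (LINT t|lborel. f (y + t) * g (y - t))" for y
    using lborel_integral_real_affine[of 1 "\<lambda>v. ?h v y" y] unfolding sh by simp
  have eq2: "integrable lborel (\<lambda>v. ?h v y) \<longleftrightarrow> integrable lborel (\<lambda>t. f (y + t) * g (y - t))" for y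
    using lborel_integrable_real_affine_iff[of 1 "\<lambda>v. ?h v y" y] unfolding sh by simp
  show "AE y in lborel. integrable lborel (\<lambda>t. f (y + t) * g (y - t))"
    using lborel_pair.AE_integrable_snd[OF int] by (simp add: eq2)
  have "(LINT v|lborel. LINT y|lborel. ?h v y) = A * B / 2"
    using has_bochner_integral_integral_eq[OF f] by (simp add: has_bochner_integral_integral_eq[OF g2])
  then show "has_bochner_integral lborel (\<lambda>y. LINT t|lborel. f (y + t) * g (y - t)) (A * B / 2)"
    using lborel_pair.integrable_snd[OF int] lborel_pair.Fubini_integral[OF int]
    by (simp add: has_bochner_integral_iff eq1)
qed

text \<open>Reflection carries the second summand to the other half-line, and the two closed
  half-lines overlap in a null set.\<close>

lemma integral_even_part:
  fixes f :: "real \<Rightarrow> complex"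
  assumes "integrable lborel f"
  shows "(LINT t:{0..}|lborel. f t + f (- t)) = (LINT t|lborel. f t)"
proof -
  have si: "set_integrable lborel A f" if "A \<in> sets borel" for A
    using assms that unfolding set_integrable_def by (intro integrable_mult_indicator) auto
  have "integrable lborel (\<lambda>t. f (- t))"
    using lborel_integrable_real_affine[OF assms, of "-1" 0] by simp
  then have si': "set_integrable lborel A (\<lambda>t. f (- t))" if "A \<in> sets borel" for A
    using that unfolding set_integrable_def by (intro integrable_mult_indicator) auto
  have "(LINT t:{0..}|lborel. f (- t)) = (LINT t:{..0}|lborel. f t)"
    unfolding set_lebesgue_integral_def
    by (subst lborel_integral_real_affine[of "-1" _ 0]) (auto simp: indicator_def intro!: Bochner_Integration.integral_cong)
  also have "\<dots> = (LINT t:{..<0}|lborel. f t)"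
  proof (rule set_integral_null_delta)
    show "integrable lborel f" by fact
    have "sym_diff {..0} {..<0::real} = {0}" by auto
    then show "sym_diff {..0} {..<0::real} \<in> null_sets lborel" by (simp add: null_sets_def)
    show "{..0::real} \<in> sets lborel" "{..<0::real} \<in> sets lborel" by simp_all
  qed
  finally have "(LINT t:{0..}|lborel. f t + f (- t)) = (LINT t:{0..}|lborel. f t) + (LINT t:{..<0}|lborel. f t)"
    by (subst set_integral_add) (auto intro: si si')
  also have "\<dots> = (LINT t:{0..} \<union> {..<0}|lborel. f t)"
    by (rule set_integral_Un[symmetric]) (auto intro: si)
  also have "{0..} \<union> {..<0} = (UNIV :: real set)" by auto
  finally show ?thesis by (simp add: set_lebesgue_integral_def)
qed

lemma macdonald_K_eq_integral_UNIV:
  assumes "integrable lborel (\<lambda>t. complex_of_real (exp (- x * cosh t)) * exp (\<nu> * of_real t))"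
  shows "2 * macdonald_K \<nu> x = (LINT t|lborel. complex_of_real (exp (- x * cosh t)) * exp (\<nu> * of_real t))"
  unfolding integral_even_part[OF assms, symmetric] macdonald_K_def set_lebesgue_integral_def
  by (subst Bochner_Integration.integral_mult_right_zero[symmetric], rule Bochner_Integration.integral_cong)
     (simp_all add: cosh_def scaleR_conv_of_real algebra_simps)

lemma macdonald_K_measurable [measurable]: "macdonald_K \<nu> \<in> borel_measurable borel"
proof -
  have [measurable]: "(cosh :: real \<Rightarrow> real) \<in> borel_measurable borel"
    by (intro borel_measurable_continuous_onI continuous_intros)
  have [measurable]: "(\<lambda>t::real. cosh (\<nu> * complex_of_real t)) \<in> borel_measurable borel"
    by (intro borel_measurable_continuous_onI continuous_intros)
  show ?thesis
    unfolding macdonald_K_def[abs_def] set_lebesgue_integral_def by measurable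
qed

text \<open>Rotating the product of two Gamma integrals leaves \<open>exp (2 s y)\<close> times
  twice a Macdonald function at \<open>2 exp y\<close>; then \<open>x = exp (2 y)\<close> makes this
  a Mellin integral.\<close>

lemma macdonald_K_Mellin:
  assumes "s > 0"
  shows "has_bochner_integral lborel
      (\<lambda>x. indicator {0<..} x *\<^sub>R (of_real (x powr (s - 1)) * macdonald_K (\<i> * of_real \<tau>) (2 * sqrt x)))
      (Gamma (of_real s + \<i> * of_real \<tau> / 2) * Gamma (of_real s - \<i> * of_real \<tau> / 2) / 2)"
proof -
  define a b where "a = complex_of_real s + \<i> * of_real \<tau> / 2" and "b = complex_of_real s - \<i> * of_real \<tau> / 2"
  define f g where "f v = exp (a * complex_of_real v - of_real (exp v))"
    and "g v = exp (b * complex_of_real v - of_real (exp v))" for v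
  let ?K = "macdonald_K (\<i> * of_real \<tau>)"
  have fg: "has_bochner_integral lborel f (Gamma a)" "has_bochner_integral lborel g (Gamma b)"
    unfolding f_def g_def using assms by (auto intro!: Gamma_integral_exp simp: a_def b_def)
  \<comment> \<open>Uses \<open>a (y + t) + b (y - t) = 2 s y + \<i> \<tau> t\<close> and
    \<open>exp (y + t) + exp (y - t) = 2 exp y cosh t\<close>.\<close>
  have prod: "f (y + t) * g (y - t) = of_real (exp (2 * s * y)) *
      (of_real (exp (- (2 * exp y) * cosh t)) * exp (\<i> * of_real \<tau> * of_real t))" for y t
    unfolding f_def g_def a_def b_def exp_of_real[symmetric] exp_add[symmetric]
    by (rule arg_cong[where f = exp])
       (simp add: cosh_def field_simps exp_of_real exp_add exp_diff exp_minus)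
  have [measurable]: "(\<lambda>y. LINT t|lborel. f (y + t) * g (y - t)) \<in> borel_measurable borel"
    using integral_product_rotated(1)[OF fg] by (auto simp: has_bochner_integral_iff dest: borel_measurable_integrable)
  have ae: "AE y in lborel. (LINT t|lborel. f (y + t) * g (y - t)) = of_real (exp (2 * s * y)) * (2 * ?K (2 * exp y))"
    using integral_product_rotated(2)[OF fg]
  proof eventually_elim
    case (elim y)
    from integrable_mult_right[OF this, of "of_real (exp (- (2 * s * y)))"]
    have "integrable lborel (\<lambda>t. of_real (exp (- (2 * exp y) * cosh t)) * exp (\<i> * of_real \<tau> * of_real t))"
      unfolding prod by (simp add: mult.assoc[symmetric] of_real_mult[symmetric] exp_add[symmetric] del: of_real_mult)
    from macdonald_K_eq_integral_UNIV[OF this] show ?case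
      unfolding prod by simp
  qed
  have "has_bochner_integral lborel (\<lambda>y. of_real (exp (2 * s * y)) * (2 * ?K (2 * exp y))) (Gamma a * Gamma b / 2)"
    by (rule iffD1[OF has_bochner_integral_cong_AE, rotated 3, OF integral_product_rotated(1)[OF fg]])
       (use ae in simp_all)
  \<comment> \<open>The factor 1/2 cancels the 2 before \<open>?K\<close>. The form
    \<open>0 + 2 * y\<close> matches the affine substitution \<open>u = 2 y\<close>, whose Jacobian
    turns the 1/4 into 1/2.\<close>
  from has_bochner_integral_mult_right[OF this, of "1 / 2"]
  have "has_bochner_integral lborel (\<lambda>y. of_real (exp (s * (0 + 2 * y))) * ?K (2 * exp ((0 + 2 * y) / 2)))
      (Gamma a * Gamma b / 4)"
    by (simp add: mult.assoc[symmetric] mult.commute[of s])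
  then have "has_bochner_integral lborel (\<lambda>y. of_real (exp (s * y)) * ?K (2 * exp (y / 2))) (Gamma a * Gamma b / 2)"
    unfolding has_bochner_integral_iff
    by (subst (asm) lborel_integrable_real_affine_iff, simp, subst lborel_integral_real_affine[of 2 _ 0])
       (auto simp: scaleR_conv_of_real mult.commute)
  also have "(\<lambda>y. of_real (exp (s * y)) * ?K (2 * exp (y / 2))) =
      (\<lambda>y. of_real (exp y) * (of_real (exp y powr (s - 1)) * ?K (2 * sqrt (exp y))))"
  proof
    fix y :: real
    have "exp y * exp y powr (s - 1) = exp (s * y)"
      by (simp add: powr_def exp_add[symmetric] algebra_simps)
    then have "complex_of_real (exp (s * y)) = of_real (exp y) * of_real (exp y powr (s - 1))"
      by (metis of_real_mult)
    moreover have "sqrt (exp y) = exp (y / 2)"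
      by (rule real_sqrt_unique) (simp_all add: power2_eq_square exp_add[symmetric])
    ultimately show "of_real (exp (s * y)) * ?K (2 * exp (y / 2)) =
        of_real (exp y) * (of_real (exp y powr (s - 1)) * ?K (2 * sqrt (exp y)))"
      by (simp add: mult.assoc)
  qed
  finally show ?thesis
    unfolding a_def b_def by (subst (asm) complex_substitution_exp) auto
qed

section \<open>Gamma quotients and the transform of polynomials\<close>

lemma Re_pos_not_nonpos_Int: "Re z > 0 \<Longrightarrow> z \<notin> \<int>\<^sub>\<le>\<^sub>0"
  by (auto elim!: nonpos_Ints_cases)

lemma Gamma_add_of_nat:
  assumes "Re z > 0"
  shows "Gamma (z + of_nat n) = pochhammer z n * Gamma z"
proof -
  show ?thesis
    using Re_pos_not_nonpos_Int[OF assms] by (simp add: pochhammer_Gamma Gamma_eq_zero_iff)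
qed

text \<open>A factor \<open>x^n\<close> shifts the Mellin parameter from \<alpha> + 1 to \<alpha> +
  1 + n, and the resulting Gamma quotients are Pochhammer symbols. Since \<alpha> and \<tau> are
  real, \<open>cnj ?a = ?b\<close>, so the squared modulus is \<open>Gamma ?a * Gamma ?b\<close> and
  cancels.\<close>

lemma KL_polynomial:
  fixes \<alpha> \<tau> :: real
  assumes "\<alpha> \<ge> 0"
  shows "KL \<alpha> (\<lambda>x. poly p (complex_of_real x)) \<tau> =
    (\<Sum>n\<le>degree p. coeff p n * (pochhammer (complex_of_real \<alpha> + 1 - \<i> * of_real \<tau> / 2) n
              * pochhammer (complex_of_real \<alpha> + 1 + \<i> * of_real \<tau> / 2) n))"
proof -
  let ?K = "macdonald_K (\<i> * of_real \<tau>)"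
  let ?a = "complex_of_real \<alpha> + 1 + \<i> * of_real \<tau> / 2" and ?b = "complex_of_real \<alpha> + 1 - \<i> * of_real \<tau> / 2"
  have pos: "Re ?a > 0" "Re ?b > 0" using assms by auto
  have "cnj ?a = ?b" by (simp add: complex_eq_iff)
  then have G: "complex_of_real ((cmod (Gamma ?a))\<^sup>2) = Gamma ?a * Gamma ?b"
    by (simp only: complex_norm_square cnj_Gamma)
  have nz: "Gamma ?a \<noteq> 0" "Gamma ?b \<noteq> 0"
    using Re_pos_not_nonpos_Int pos by (simp_all only: Gamma_eq_zero_iff not_False_eq_True)
  have "has_bochner_integral lborel
      (\<lambda>x. \<Sum>n\<le>degree p. coeff p n * (indicator {0<..} x *\<^sub>R (of_real (x powr (\<alpha> + 1 + real n - 1)) * ?K (2 * sqrt x))))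
      (\<Sum>n\<le>degree p. coeff p n * (Gamma (of_real (\<alpha> + 1 + real n) + \<i> * of_real \<tau> / 2) * Gamma (of_real (\<alpha> + 1 + real n) - \<i> * of_real \<tau> / 2) / 2))"
    using assms by (intro has_bochner_integral_sum has_bochner_integral_mult_right macdonald_K_Mellin) auto
  also have "(\<lambda>x. \<Sum>n\<le>degree p. coeff p n * (indicator {0<..} x *\<^sub>R (of_real (x powr (\<alpha> + 1 + real n - 1)) * ?K (2 * sqrt x))))
     = (\<lambda>x. indicator {0<..} x *\<^sub>R (of_real (x powr \<alpha>) * ?K (2 * sqrt x) * poly p (of_real x)))"
    by (auto simp: fun_eq_iff indicator_def poly_altdef sum_distrib_left powr_add powr_realpow algebra_simps intro!: sum.cong)
  finally have "(LINT x:{0<..}|lborel. of_real (x powr \<alpha>) * ?K (2 * sqrt x) * poly p (of_real x)) =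
     (\<Sum>n\<le>degree p. coeff p n * (Gamma (of_real (\<alpha> + 1 + real n) + \<i> * of_real \<tau> / 2) * Gamma (of_real (\<alpha> + 1 + real n) - \<i> * of_real \<tau> / 2) / 2))"
    unfolding set_lebesgue_integral_def by (rule has_bochner_integral_integral_eq)
  also have "\<dots> = (\<Sum>n\<le>degree p. coeff p n * (pochhammer ?b n * pochhammer ?a n)) * (Gamma ?a * Gamma ?b / 2)"
    unfolding sum_distrib_right
  proof (rule sum.cong)
    fix n
    have "of_real (\<alpha> + 1 + real n) + \<i> * of_real \<tau> / 2 = ?a + of_nat n"
         "of_real (\<alpha> + 1 + real n) - \<i> * of_real \<tau> / 2 = ?b + of_nat n" by simp_all
    then show "coeff p n * (Gamma (of_real (\<alpha> + 1 + real n) + \<i> * of_real \<tau> / 2) * Gamma (of_real (\<alpha> + 1 + real n) - \<i> * of_real \<tau> / 2) / 2)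
       = coeff p n * (pochhammer ?b n * pochhammer ?a n) * (Gamma ?a * Gamma ?b / 2)"
      by (simp only: Gamma_add_of_nat pos) (simp add: algebra_simps)
  qed simp
  finally show ?thesis
    using nz unfolding KL_def G by (simp add: field_simps)
qed

subsection \<open>Dual functionals of a polynomial sequence\<close>

interpretation poly_space: vector_space "smult :: 'a::field \<Rightarrow> 'a poly \<Rightarrow> 'a poly"
  by unfold_locales (simp_all add: smult_add_right smult_add_left)

text \<open>In a linear dependence, the term of largest degree with nonzero coefficient has nothing
  to cancel its leading coefficient.\<close>

lemma independent_range_degree:
  fixes P :: "nat \<Rightarrow> 'a::field poly"
  assumes "\<And>n. P n \<noteq> 0" and "\<And>n. degree (P n) = n"
  shows "poly_space.independent (range P)"
proof
  assume "poly_space.dependent (range P)"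
  then obtain T u p0 where T: "finite T" "T \<subseteq> range P" "(\<Sum>p\<in>T. smult (u p) p) = 0"
    and p0: "p0 \<in> T" "u p0 \<noteq> 0"
    unfolding poly_space.dependent_explicit by blast
  define T' where "T' = {p \<in> T. u p \<noteq> 0}"
  have "finite T'" "p0 \<in> T'" using T p0 by (auto simp: T'_def)
  then obtain q where q: "q \<in> T'" "\<And>p. p \<in> T' \<Longrightarrow> degree p \<le> degree q"
    using finite_imageI[of T' degree] Max_in[of "degree ` T'"] Max_ge[of "degree ` T'"] by fastforce
  have inj: "p = q" if "p \<in> T'" "degree p = degree q" for p
    using that q(1) T(2) by (auto simp: T'_def assms(2) subset_iff image_iff) (metis assms(2))
  have "0 = coeff (\<Sum>p\<in>T. smult (u p) p) (degree q)" using T by simp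
  also have "\<dots> = (\<Sum>p\<in>T. u p * coeff p (degree q))" by (simp add: coeff_sum)
  also have "\<dots> = (\<Sum>p\<in>{q}. u p * coeff p (degree q))"
  proof (rule sum.mono_neutral_right)
    show "\<forall>p\<in>T - {q}. u p * coeff p (degree q) = 0"
    proof
      fix p assume p: "p \<in> T - {q}"
      show "u p * coeff p (degree q) = 0"
      proof (cases "u p = 0")
        case False
        with p have "p \<in> T'" by (simp add: T'_def)
        with q inj p have "degree p < degree q" by (force simp: le_less)
        then show ?thesis by (simp add: coeff_eq_0)
      qed simp
    qed
  qed (use T q in \<open>auto simp: T'_def\<close>)
  finally have "coeff q (degree q) = 0" using q(1) by (auto simp: T'_def)
  then show False using q(1) T(2) assms(1) by (auto simp: T'_def)
qed

text \<open>Modulo terms of index above \<open>n - m\<close>, \<open>x P_n\<close> is a nonzero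
  multiple of \<open>P_(n-m)\<close>. Hence each factor \<open>x\<close> lowers the least relevant
  index by exactly \<open>m\<close>, and induction on \<open>j\<close> reduces the conditions to the
  duality at \<open>j = 0\<close>.\<close>

lemma m_orthogonalI:
  assumes m: "m > 0" and deg: "\<And>n. P n \<noteq> 0" "\<And>n. degree (P n) = n"
    and rec: "\<And>n. n \<ge> m \<Longrightarrow>
      \<exists>e. e \<noteq> 0 \<and> monom 1 1 * P n - smult e (P (n - m)) \<in> poly_space.span (P ` {n - m<..})"
  shows "m_orthogonal m P"
proof -
  interpret vs: vector_space_pair "smult :: complex \<Rightarrow> complex poly \<Rightarrow> complex poly" "(*) :: complex \<Rightarrow> complex \<Rightarrow> complex" ..
  have inj: "inj P" by (metis deg(2) injI)
  have "\<exists>w. Vector_Spaces.linear smult (*) w \<and>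
        (\<forall>j n. n \<ge> j * m + k + 1 \<longrightarrow> w (monom 1 j * P n) = 0) \<and>
        (\<forall>j. w (monom 1 j * P (j * m + k)) \<noteq> 0)" for k
  proof -
    \<comment> \<open>The coordinate functional of \<open>P k\<close>, extended linearly from the
      independent family.\<close>
    obtain w where w: "Vector_Spaces.linear smult (*) w"
      and "\<forall>p\<in>range P. w p = (if p = P k then 1 else 0 :: complex)"
      using vs.linear_independent_extend[OF independent_range_degree[OF deg], of "\<lambda>p. if p = P k then 1 else 0"] by blast
    then have wP: "w (P n) = (if n = k then 1 else 0)" for n
      using inj by (auto dest: injD)
    have main: "(\<forall>n > j * m + k. w (monom 1 j * P n) = 0) \<and> w (monom 1 j * P (j * m + k)) \<noteq> 0" for j
    proof (induction j)
      case 0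
      then show ?case using wP by (auto simp: monom_0 one_pCons[symmetric])
    next
      case (Suc j)
      interpret w: Vector_Spaces.linear smult "(*)" w by (rule w)
      interpret v: Vector_Spaces.linear smult "(*)" "\<lambda>p. w (monom 1 j * p)"
        by unfold_locales (simp_all add: distrib_left w.add w.scale)
      have *: "\<exists>e. e \<noteq> 0 \<and> w (monom 1 (Suc j) * P n) = e * w (monom 1 j * P (n - m))"
        if n: "n \<ge> Suc j * m + k" for n
      proof -
        obtain e where e: "e \<noteq> 0" "monom 1 1 * P n - smult e (P (n - m)) \<in> poly_space.span (P ` {n - m<..})"
          using rec[of n] n by auto
        \<comment> \<open>The generators \<open>P i\<close> have
          \<open>i > n - m \<ge> j * m + k\<close>, so the induction hypothesis kills all of
          them.\<close>
        have "w (monom 1 j * (monom 1 1 * P n - smult e (P (n - m)))) = 0"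
          by (rule v.eq_0_on_span[OF _ e(2)]) (use Suc n in auto)
        then have "w (monom 1 j * (monom 1 1 * P n)) = e * w (monom 1 j * P (n - m))"
          by (simp only: v.diff v.scale) simp
        also have "monom 1 j * (monom 1 1 * P n) = monom 1 (Suc j) * P n"
          by (simp add: mult.assoc[symmetric] mult_monom)
        finally show ?thesis using e by blast
      qed
      show ?case
      proof (intro conjI allI impI)
        fix n assume "n > Suc j * m + k"
        then show "w (monom 1 (Suc j) * P n) = 0" using *[of n] Suc by auto
      next
        show "w (monom 1 (Suc j) * P (Suc j * m + k)) \<noteq> 0" using *[of "Suc j * m + k"] Suc by auto
      qed
    qed
    show ?thesis using w main by (intro exI[of _ w]) (auto simp: less_eq_Suc_le)
  qed
  then show ?thesis
    unfolding m_orthogonal_def using m deg by metis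
qed

subsection \<open>The transform as a linear map on polynomials\<close>

text \<open>A polynomial is the sum of its monomials. The codomain is general, so that operator
  identities and identities between values at a point can both be checked on monomials.\<close>

lemma additive_poly_eqI:
  fixes F G :: "'a::comm_ring_1 poly \<Rightarrow> 'b::ab_group_add"
  assumes "\<And>p q. F (p + q) = F p + F q" "\<And>p q. G (p + q) = G p + G q"
    and "\<And>c n. F (monom c n) = G (monom c n)"
  shows "F p = G p"
proof -
  have 0: "F 0 = 0" "G 0 = 0" using assms(1)[of 0 0] assms(2)[of 0 0] by simp_all
  have "F (\<Sum>n\<in>A. monom (coeff p n) n) = G (\<Sum>n\<in>A. monom (coeff p n) n)" if "finite A" for A
    using that by induction (simp_all add: assms 0)
  from this[of "{..degree p}"] show ?thesis by (simp add: poly_as_sum_of_monoms)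
qed

text \<open>The parameter \<open>a\<close> stands for \<alpha> + 1, the indeterminate for
  \<open>\<tau>^2 / 4\<close>.\<close>

definition KL_basis :: "complex \<Rightarrow> nat \<Rightarrow> complex poly" where
  "KL_basis a n = (\<Prod>k<n. [:(a + of_nat k)\<^sup>2, 1:])"

text \<open>An algebraic model of the transform; \<open>KL_poly_eq_KL_map\<close> identifies the
  two.\<close>

definition KL_map :: "complex \<Rightarrow> complex poly \<Rightarrow> complex poly" where
  "KL_map a p = (\<Sum>n\<le>degree p. smult (coeff p n) (KL_basis a n))"

text \<open>The operator \<open>a + x d/dx\<close>. It multiplies \<open>x^n\<close> by
  \<open>a + n\<close>, so its square accounts for the constants \<open>(a + n)^2\<close> in
  \<open>KL_basis\<close>.\<close>

definition euler_op :: "complex \<Rightarrow> complex poly \<Rightarrow> complex poly" where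
  "euler_op a p = smult a p + [:0, 1:] * pderiv p"

lemma poly_KL_basis:
  "poly (KL_basis a n) (\<tau>\<^sup>2 / 4) = pochhammer (a - \<i> * \<tau> / 2) n * pochhammer (a + \<i> * \<tau> / 2) n"
proof -
  have "(a + of_nat k)\<^sup>2 + \<tau>\<^sup>2 / 4 = (a - \<i> * \<tau> / 2 + of_nat k) * (a + \<i> * \<tau> / 2 + of_nat k)" for k :: nat
    by (simp add: power2_eq_square field_simps) 
  then show ?thesis
    by (simp add: KL_basis_def poly_prod pochhammer_prod prod.distrib lessThan_atLeast0)
qed

lemma degree_KL_basis: "degree (KL_basis a n) = n"
  unfolding KL_basis_def by (subst degree_prod_eq_sum_degree) auto

lemma lead_coeff_KL_basis: "coeff (KL_basis a n) n = 1"
proof -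
  have "lead_coeff (KL_basis a n) = 1" unfolding KL_basis_def by (subst lead_coeff_prod) simp
  then show ?thesis by (simp add: degree_KL_basis)
qed

lemma KL_map_eq_sum:
  assumes "degree p \<le> N"
  shows "KL_map a p = (\<Sum>n\<le>N. smult (coeff p n) (KL_basis a n))"
  unfolding KL_map_def
  by (rule sum.mono_neutral_left) (use assms in \<open>auto simp: coeff_eq_0\<close>)

lemma KL_map_add: "KL_map a (p + q) = KL_map a p + KL_map a q"
proof -
  let ?N = "max (degree p) (degree q)"
  have "degree (p + q) \<le> ?N" by (rule degree_add_le) auto
  then show ?thesis
    by (simp add: KL_map_eq_sum[of _ ?N] smult_add_left sum.distrib)
qed

lemma KL_map_smult: "KL_map a (smult c p) = smult c (KL_map a p)"
  by (subst KL_map_eq_sum[of _ "degree p"])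
     (auto simp: KL_map_def poly_space.scale_sum_right degree_smult_le)

lemma KL_map_diff: "KL_map a (p - q) = KL_map a p - KL_map a q"
  using KL_map_add[of a "p - q" q] by simp

lemma KL_map_monom: "KL_map a (monom c n) = smult c (KL_basis a n)"
proof -
  have "(\<Sum>k\<le>n. smult (coeff (monom c n) k) (KL_basis a k)) = (\<Sum>k\<in>{n}. smult (coeff (monom c n) k) (KL_basis a k))"
    by (rule sum.mono_neutral_right) auto
  then show ?thesis
    by (subst KL_map_eq_sum[OF degree_monom_le]) simp
qed

text \<open>The map is triangular with unit diagonal, since \<open>KL_basis a n\<close> is monic of
  degree \<open>n\<close>.\<close>

lemma degree_KL_map:
  assumes "p \<noteq> 0"
  shows "degree (KL_map a p) = degree p" and "KL_map a p \<noteq> 0"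
proof -
  have "coeff (KL_map a p) (degree p) = (\<Sum>n\<in>{degree p}. coeff p n * coeff (KL_basis a n) (degree p))"
    unfolding KL_map_def coeff_sum coeff_smult
    by (rule sum.mono_neutral_right) (auto simp: coeff_eq_0 degree_KL_basis)
  then have nz: "coeff (KL_map a p) (degree p) \<noteq> 0" using assms by (simp add: lead_coeff_KL_basis)
  then show "KL_map a p \<noteq> 0" by auto
  have "degree (KL_map a p) \<le> degree p"
    unfolding KL_map_def by (intro degree_sum_le) (auto intro: order_trans[OF degree_smult_le] simp: degree_KL_basis)
  with le_degree[OF nz] show "degree (KL_map a p) = degree p" by simp
qed

lemma euler_op_monom: "euler_op a (monom c n) = monom ((a + of_nat n) * c) n"
  by (cases n) (simp_all add: euler_op_def pderiv_monom smult_monom monom_Suc[symmetric] add_monom algebra_simps)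

lemma euler_op_add: "euler_op a (p + q) = euler_op a p + euler_op a q"
  by (simp add: euler_op_def smult_add_right pderiv_add algebra_simps)

lemma euler_op_smult: "euler_op a (smult c p) = smult c (euler_op a p)"
  by (simp add: euler_op_def smult_add_right pderiv_smult mult.commute)

lemma KL_map_mult_X:
  "KL_map a ([:0, 1:] * p) = [:0, 1:] * KL_map a p + KL_map a (euler_op a (euler_op a p))"
proof (rule additive_poly_eqI[where F = "\<lambda>p. KL_map a ([:0, 1:] * p)"])
  fix c :: complex and n
  have "KL_basis a (Suc n) = [:(a + of_nat n)\<^sup>2, 1:] * KL_basis a n"
    by (simp add: KL_basis_def mult.commute)
  moreover have "[:0, 1:] * monom c n = monom c (Suc n)" by (simp add: monom_Suc one_pCons[symmetric])
  ultimately show "KL_map a ([:0, 1:] * monom c n) =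
      [:0, 1:] * KL_map a (monom c n) + KL_map a (euler_op a (euler_op a (monom c n)))"
    by (simp add: euler_op_monom KL_map_monom power2_eq_square smult_add_right algebra_simps)
qed (simp_all only: distrib_left KL_map_add euler_op_add, simp_all)

text \<open>Both products share the factor \<open>(A)_m (B)_m\<close>. What remains is
  \<open>(A + m)(B - 1) - (A - 1)(B + m) = (m + 1)(B - A)\<close>, and
  \<open>B - A = \<i> \<tau>\<close> cancels against the divisor.\<close>

lemma central_diff_KL_basis:
  assumes "\<tau> \<noteq> 0"
  shows "central_diff \<i> (\<lambda>t. poly (KL_basis a n) (t\<^sup>2 / 4)) \<tau>
    = of_nat n / 2 * poly (KL_basis (a + 1 / 2) (n - 1)) (\<tau>\<^sup>2 / 4)"
proof (cases n)
  case 0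
  then show ?thesis by (simp add: KL_basis_def central_diff_def)
next
  case (Suc m)
  \<comment> \<open>The Pochhammer arguments belonging to \<open>a + 1 / 2\<close>; shifting \<tau>
    by \<i> and by -\<i> yields the pairs \<open>A, B - 1\<close> and
    \<open>A - 1, B\<close>.\<close>
  define A B where "A = a + 1 / 2 - \<i> * \<tau> / 2" and "B = a + 1 / 2 + \<i> * \<tau> / 2"
  have shift: "a - \<i> * (\<tau> + \<i>) / 2 = A" "a + \<i> * (\<tau> + \<i>) / 2 = B - 1"
     "a - \<i> * (\<tau> - \<i>) / 2 = A - 1" "a + \<i> * (\<tau> - \<i>) / 2 = B"
    by (simp_all add: A_def B_def field_simps)
  have up: "pochhammer x (Suc m) = pochhammer x m * (x + of_nat m)"
    and down: "pochhammer (x - 1) (Suc m) = (x - 1) * pochhammer x m" for x :: complex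
    using pochhammer_Suc[of x m] pochhammer_rec[of "x - 1" m] by simp_all
  have BA: "B - A = \<i> * \<tau>" by (simp add: A_def B_def)
  have "central_diff \<i> (\<lambda>t. poly (KL_basis a n) (t\<^sup>2 / 4)) \<tau> =
     (pochhammer A (Suc m) * pochhammer (B - 1) (Suc m) - pochhammer (A - 1) (Suc m) * pochhammer B (Suc m)) / (2 * \<i> * \<tau>)"
    unfolding central_diff_def poly_KL_basis shift Suc ..
  also have "pochhammer A (Suc m) * pochhammer (B - 1) (Suc m) - pochhammer (A - 1) (Suc m) * pochhammer B (Suc m)
     = of_nat (Suc m) * (B - A) * (pochhammer A m * pochhammer B m)"
    \<comment> \<open>\<open>down\<close> goes first, so that only the symbols at \<open>A\<close>
      and \<open>B\<close> of length \<open>Suc m\<close> are left for \<open>up\<close>.\<close>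
    unfolding down unfolding up by (simp add: algebra_simps)
  also have "\<dots> / (2 * \<i> * \<tau>) = of_nat n / 2 * (pochhammer A m * pochhammer B m)"
    unfolding BA using assms Suc by (simp add: field_simps)
  finally show ?thesis
    unfolding poly_KL_basis A_def B_def Suc by simp
qed

lemma central_diff_KL_map:
  assumes "\<tau> \<noteq> 0"
  shows "central_diff \<i> (\<lambda>t. poly (KL_map a p) (t\<^sup>2 / 4)) \<tau>
    = 1 / 2 * poly (KL_map (a + 1 / 2) (pderiv p)) (\<tau>\<^sup>2 / 4)"
proof (rule additive_poly_eqI[where F = "\<lambda>p. central_diff \<i> (\<lambda>t. poly (KL_map a p) (t\<^sup>2 / 4)) \<tau>"])
  fix c n
  have "central_diff \<i> (\<lambda>t. poly (KL_map a (monom c n)) (t\<^sup>2 / 4)) \<tau>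
    = c * central_diff \<i> (\<lambda>t. poly (KL_basis a n) (t\<^sup>2 / 4)) \<tau>"
    by (simp add: KL_map_monom central_diff_def algebra_simps)
  then show "central_diff \<i> (\<lambda>t. poly (KL_map a (monom c n)) (t\<^sup>2 / 4)) \<tau> =
       1 / 2 * poly (KL_map (a + 1 / 2) (pderiv (monom c n))) (\<tau>\<^sup>2 / 4)"
    using assms by (simp add: central_diff_KL_basis pderiv_monom KL_map_monom)
qed (simp_all add: KL_map_add pderiv_add central_diff_def add_divide_distrib diff_divide_distrib algebra_simps)

subsection \<open>The Appell polynomials and their transforms\<close>

text \<open>Merges initial values and recurrence: for \<open>n < d\<close> the binomial vanishes and
  masks the truncated index \<open>n - d\<close>.\<close>

lemma H_hat_Suc:
  "H_hat d (Suc n) = [:0, 1:] * H_hat d n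
     - smult (inverse (of_nat (d + 1)) * of_nat (n choose d)) (H_hat d (n - d))"
proof (cases "n < d")
  case True
  then show ?thesis by (simp add: H_hat_initial monom_Suc binomial_eq_0)
next
  case False
  then show ?thesis using H_hat_rec[of d "n - d"] by simp
qed

lemma H_hat_monic: "degree (H_hat d n) = n \<and> lead_coeff (H_hat d n) = 1"
proof (induction n rule: less_induct)
  case (less n)
  show ?case
  proof (cases n)
    case 0
    then show ?thesis by (simp add: H_hat_initial degree_monom_eq)
  next
    case (Suc m)
    have IH: "degree (H_hat d m) = m" "lead_coeff (H_hat d m) = 1" "degree (H_hat d (m - d)) = m - d"
      using less[of m] less[of "m - d"] Suc by auto
    then have "H_hat d m \<noteq> 0" by auto
    then have deg: "degree ([:0, 1:] * H_hat d m) = n"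
      using IH Suc by (simp add: degree_pCons_eq)
    have lt: "degree (- smult (inverse (of_nat (d + 1)) * of_nat (m choose d)) (H_hat d (m - d))) < n"
      using IH Suc by (auto intro: le_less_trans[OF degree_smult_le])
    have eq: "H_hat d n = [:0, 1:] * H_hat d m + - smult (inverse (of_nat (d + 1)) * of_nat (m choose d)) (H_hat d (m - d))"
      using H_hat_Suc[of d m] Suc by simp
    show ?thesis
      unfolding eq using degree_add_eq_left[OF lt[folded deg]] coeff_eq_0[OF lt] deg IH Suc
      by simp
  qed
qed

text \<open>The Appell property. Differentiating the recurrence gives
  \<open>H_n + x H_n' - \<gamma>_n H_(n-d)'\<close>; by induction and
  \<open>\<gamma>_n (n - d) = n \<gamma>_(n-1)\<close> the last two terms recombine to
  \<open>n H_n\<close>.\<close>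

lemma pderiv_H_hat_Suc: "pderiv (H_hat d (Suc n)) = smult (of_nat (Suc n)) (H_hat d n)"
proof (induction n rule: less_induct)
  case (less n)
  define \<gamma> where "\<gamma> k = inverse (of_nat (d + 1)) * complex_of_nat (k choose d)" for k
  have rec: "H_hat d (Suc k) = [:0, 1:] * H_hat d k - smult (\<gamma> k) (H_hat d (k - d))" for k
    unfolding \<gamma>_def by (rule H_hat_Suc)
  have pd: "pderiv (H_hat d (Suc n)) = H_hat d n + [:0, 1:] * pderiv (H_hat d n) - smult (\<gamma> n) (pderiv (H_hat d (n - d)))"
    by (simp add: rec[of n] pderiv_diff pderiv_smult pderiv_pCons algebra_simps)
  show ?case
  proof (cases n)
    case 0
    then show ?thesis unfolding pd by (simp add: H_hat_initial monom_0 pderiv_pCons)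
  next
    case (Suc m)
    have 1: "pderiv (H_hat d n) = smult (of_nat n) (H_hat d m)" using less[of m] Suc by simp
    have "smult (\<gamma> n) (pderiv (H_hat d (n - d))) = smult (of_nat n * \<gamma> m) (H_hat d (m - d))"
    proof (cases "n \<le> d")
      \<comment> \<open>Here \<open>n - d\<close> is 0 and \<open>H_0\<close> is constant, while
        \<open>m choose d\<close> vanishes because \<open>m < d\<close>.\<close>
      case True
      then show ?thesis using Suc by (simp add: \<gamma>_def H_hat_initial monom_0 pderiv_pCons)
    next
      case False
      then have nd: "n - d = Suc (m - d)" using Suc by simp
      have "(n - d) * (n choose d) = n * (m choose d)"
        using binomial_absorb_comp[of n d] Suc by simp
      then have "of_nat (n - d) * complex_of_nat (n choose d) = of_nat n * of_nat (m choose d)"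
        by (metis of_nat_mult)
      then have "\<gamma> n * of_nat (n - d) = of_nat n * \<gamma> m"
        by (simp add: \<gamma>_def algebra_simps)
      moreover have "pderiv (H_hat d (n - d)) = smult (of_nat (n - d)) (H_hat d (m - d))"
        using less[of "m - d"] nd Suc by simp
      ultimately show ?thesis by simp
    qed
    moreover have "[:0, 1:] * H_hat d m = H_hat d n + smult (\<gamma> m) (H_hat d (m - d))"
      using rec[of m] Suc by simp
    ultimately show ?thesis
      unfolding pd 1 mult_smult_right by (simp only: smult_add_right smult_smult) (simp add: smult_add_left)
  qed
qed

text \<open>Binomial absorption. At \<open>k = n\<close> it simplifies \<open>x H_n'\<close>; at
  \<open>k = n - d - 1\<close> it gives the lowest coefficient of the recurrence its final
  form.\<close>

lemma of_nat_choose_absorb: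
  "of_nat k * (inverse (of_nat (d + 1)) * of_nat ((k - 1) choose d)) = (of_nat (k choose (d + 1)) :: 'a::field_char_0)"
proof -
  have "(d + 1) * (k choose (d + 1)) = k * ((k - 1) choose d)"
    using times_binomial_minus1_eq[of "d + 1" k] by simp
  then have "of_nat (d + 1) * of_nat (k choose (d + 1)) = (of_nat k * of_nat ((k - 1) choose d) :: 'a)"
    by (metis of_nat_mult)
  moreover have "of_nat (d + 1) \<noteq> (0 :: 'a)" by (simp only: of_nat_eq_0_iff)
  ultimately show ?thesis by (simp add: field_simps)
qed

text \<open>By the Appell property \<open>x H_n' = n x H_(n-1)\<close>, which the recurrence expands
  into two terms.\<close>

lemma euler_op_H_hat:
  "euler_op a (H_hat d n) = smult (a + of_nat n) (H_hat d n) + smult (of_nat (n choose (d + 1))) (H_hat d (n - d - 1))"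
proof (cases n)
  case 0
  then show ?thesis by (simp add: euler_op_def H_hat_initial monom_0 pderiv_pCons)
next
  case (Suc m)
  have x: "[:0, 1:] * H_hat d m = H_hat d n + smult (inverse (of_nat (d + 1)) * of_nat (m choose d)) (H_hat d (m - d))"
    using H_hat_Suc[of d m] Suc by simp
  have "[:0, 1:] * pderiv (H_hat d n) = smult (of_nat n) ([:0, 1:] * H_hat d m)"
    using pderiv_H_hat_Suc[of d m] Suc by simp
  also have "\<dots> = smult (of_nat n) (H_hat d n) + smult (of_nat (n choose (d + 1))) (H_hat d (n - d - 1))"
    using of_nat_choose_absorb[of n d, where ?'a = complex] Suc unfolding x by (simp add: smult_add_right)
  finally show ?thesis by (simp add: euler_op_def smult_add_left)
qed

text \<open>\<open>KL_map_mult_X\<close> brings in the square of the Euler operator, and each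
  application lowers the index by 0 or \<open>d + 1\<close>. Truncated indices occur only next to
  vanishing binomials.\<close>

lemma KL_map_H_hat_rec:
  "KL_map a (H_hat d (Suc n)) =
     [:(a + of_nat n)\<^sup>2, 1:] * KL_map a (H_hat d n)
     - smult (inverse (of_nat (d + 1)) * of_nat (n choose d)) (KL_map a (H_hat d (n - d)))
     + smult ((2 * of_nat n + 2 * a - 1 - of_nat d) * of_nat (n choose (d + 1))) (KL_map a (H_hat d (n - d - 1)))
     + smult (of_nat (n choose (d + 1)) * of_nat ((n - d - 1) choose (d + 1))) (KL_map a (H_hat d (n - 2 * d - 2)))"
proof -
  let ?c = "\<lambda>k. complex_of_nat (k choose (d + 1))" and ?k = "n - d - 1"
  have k: "?c n * (a + of_nat n + (a + of_nat ?k)) = (2 * of_nat n + 2 * a - 1 - of_nat d) * ?c n"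
  proof (cases "n \<le> d")
    case False
    then have "complex_of_nat ?k = of_nat n - of_nat d - 1" by (simp add: of_nat_diff)
    then show ?thesis by (simp only:) (simp add: algebra_simps)
  qed simp
  \<comment> \<open>As atoms, these sums are not split by the distributivity rules below.\<close>
  define A K where "A = a + of_nat n" and "K = a + of_nat ?k"
  have i: "?k - d - 1 = n - 2 * d - 2" by simp
  have "KL_map a (euler_op a (euler_op a (H_hat d n))) =
     smult ((a + of_nat n)\<^sup>2) (KL_map a (H_hat d n))
     + smult (?c n * (a + of_nat n + (a + of_nat ?k))) (KL_map a (H_hat d ?k))
     + smult (?c n * ?c ?k) (KL_map a (H_hat d (?k - d - 1)))"
    unfolding A_def[symmetric] K_def[symmetric]
    by (simp only: euler_op_H_hat[of a d n, folded A_def] euler_op_H_hat[of a d ?k, folded K_def] euler_op_add euler_op_smult KL_map_add KL_map_smult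
        smult_add_right smult_add_left smult_smult distrib_left distrib_right power2_eq_square ac_simps)
  then show ?thesis
    unfolding k i H_hat_Suc KL_map_diff KL_map_mult_X KL_map_smult by simp
qed

text \<open>Solved for \<open>y S_n\<close>, the recurrence has lowest index
  \<open>n - 2 d - 2\<close>, and both binomials in its coefficient \<open>e\<close> are positive
  once \<open>n \<ge> 2 d + 2\<close>.\<close>

lemma m_orthogonal_KL_map_H_hat:
  assumes "d \<ge> 1"
  shows "m_orthogonal (2 * d + 2) (\<lambda>n. KL_map a (H_hat d n))"
proof (rule m_orthogonalI)
  fix n
  have nz: "H_hat d n \<noteq> 0" using H_hat_monic[of d n] by auto
  show "KL_map a (H_hat d n) \<noteq> 0" "degree (KL_map a (H_hat d n)) = n"
    using degree_KL_map[OF nz] H_hat_monic[of d n] by auto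
next
  fix n assume n: "2 * d + 2 \<le> n"
  let ?P = "\<lambda>n. KL_map a (H_hat d n)"
  let ?S = "poly_space.span (?P ` {n - (2 * d + 2)<..})"
  define e where "e = - complex_of_nat (n choose (d + 1)) * of_nat ((n - d - 1) choose (d + 1))"
  have "e \<noteq> 0" using n by (simp add: e_def)
  have base: "smult c (?P i) \<in> ?S" if "i > n - (2 * d + 2)" for c i
    using that by (intro poly_space.span_scale poly_space.span_base) auto
  have "monom 1 1 * ?P n - smult e (?P (n - (2 * d + 2))) =
      smult 1 (?P (Suc n)) - smult ((a + of_nat n)\<^sup>2) (?P n)
      + smult (inverse (of_nat (d + 1)) * of_nat (n choose d)) (?P (n - d))
      - smult ((2 * of_nat n + 2 * a - 1 - of_nat d) * of_nat (n choose (d + 1))) (?P (n - d - 1))"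
    unfolding KL_map_H_hat_rec by (simp add: e_def monom_Suc monom_0 algebra_simps)
  also have "\<dots> \<in> ?S"
    by (intro poly_space.span_add poly_space.span_diff base) (use n in auto)
  finally show "\<exists>e. e \<noteq> 0 \<and> monom 1 1 * ?P n - smult e (?P (n - (2 * d + 2))) \<in> ?S"
    using \<open>e \<noteq> 0\<close> by blast
qed simp

section \<open>Agreement of the algebraic map with the integral transform\<close>

lemma poly_eqI_infinite:
  fixes p q :: "'a::idom poly"
  assumes "infinite A" and "\<And>x. x \<in> A \<Longrightarrow> poly p x = poly q x"
  shows "p = q"
proof (rule ccontr)
  assume "p \<noteq> q"
  then have "finite {x. poly (p - q) x = 0}" by (intro poly_roots_finite) simp
  moreover have "A \<subseteq> {x. poly (p - q) x = 0}" using assms(2) by auto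
  ultimately show False using assms(1) finite_subset by blast
qed

lemma poly_KL_map_eq_KL:
  assumes "\<alpha> \<ge> 0"
  shows "poly (KL_map (of_real \<alpha> + 1) p) (complex_of_real (\<tau>\<^sup>2 / 4)) = KL \<alpha> (\<lambda>x. poly p (complex_of_real x)) \<tau>"
  using poly_KL_basis[of "of_real \<alpha> + 1" _ "complex_of_real \<tau>"]
  by (simp add: KL_polynomial[OF assms] KL_map_def poly_sum)

text \<open>For positive \<tau> the points \<open>\<tau>^2 / 4\<close> are infinitely many, so the
  polynomial described by \<open>THE\<close> is unique.\<close>

lemma KL_poly_eq_KL_map:
  assumes "\<alpha> \<ge> 0"
  shows "KL_poly \<alpha> p = KL_map (of_real \<alpha> + 1) p"
  unfolding KL_poly_def
proof (rule the_equality)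
  show "\<forall>\<tau>::real. \<tau> > 0 \<longrightarrow> poly (KL_map (of_real \<alpha> + 1) p) (complex_of_real (\<tau>\<^sup>2 / 4)) =
      KL \<alpha> (\<lambda>x. poly p (complex_of_real x)) \<tau>"
    using poly_KL_map_eq_KL[OF assms] by blast
next
  fix q assume q: "\<forall>\<tau>::real. \<tau> > 0 \<longrightarrow> poly q (complex_of_real (\<tau>\<^sup>2 / 4)) = KL \<alpha> (\<lambda>x. poly p (complex_of_real x)) \<tau>"
  have "inj_on (\<lambda>\<tau>. complex_of_real (\<tau>\<^sup>2 / 4)) {0<..}"
    by (auto intro!: inj_onI simp flip: of_real_power)
  then have "infinite ((\<lambda>\<tau>. complex_of_real (\<tau>\<^sup>2 / 4)) ` {0<..})"
    using infinite_Ioi[of "0::real"] finite_imageD by blast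
  then show "q = KL_map (of_real \<alpha> + 1) p"
    by (rule poly_eqI_infinite) (use q poly_KL_map_eq_KL[OF assms] in auto)
qed

lemma S_KL_of_nat: "\<alpha> \<ge> 0 \<Longrightarrow> S_KL d \<alpha> (int n) = KL_map (of_real \<alpha> + 1) (H_hat d n)"
  by (simp add: S_KL_def KL_poly_eq_KL_map)

lemma S_KL_diff:
  assumes "\<alpha> \<ge> 0" and "k \<le> n"
  shows "S_KL d \<alpha> (int n - int k) = KL_map (of_real \<alpha> + 1) (H_hat d (n - k))"
  using S_KL_of_nat[OF assms(1), of d "n - k"] assms(2) by (simp add: of_nat_diff)

text \<open>Passes from truncated natural indices to integer ones: wherever the two disagree, an
  accompanying binomial is zero.\<close>

lemma S_KL_rec:
  fixes y :: complex
  assumes "\<alpha> \<ge> 0"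
  shows "poly (S_KL d \<alpha> (int n + 1)) y
            = (y + (complex_of_real \<alpha>)\<^sup>2
                 + (of_nat n + 1) * (of_nat n + 1 + 2 * complex_of_real \<alpha>))
                * poly (S_KL d \<alpha> (int n)) y
              - inverse (of_nat d + 1) * of_nat (n choose d)
                * poly (S_KL d \<alpha> (int n - int d)) y
              + (2 * of_nat n + 2 * complex_of_real \<alpha> + 1 - of_nat d) * of_nat (n choose (d + 1))
                * poly (S_KL d \<alpha> (int n - int d - 1)) y
              + (of_nat n - of_nat d - 1) * of_nat (n choose (d + 1))
                * inverse (of_nat d + 1) * of_nat ((n - d - 2) choose d)
                * poly (S_KL d \<alpha> (int n - 2 * int d - 2)) y"
proof -
  define a where "a = complex_of_real \<alpha> + 1"
  let ?L = "\<lambda>k. poly (KL_map a (H_hat d k)) y"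
  have S: "poly (S_KL d \<alpha> (int n - int k)) y = ?L (n - k)" if "k \<le> n" for k
    using S_KL_diff[OF assms that] by (simp add: a_def)
  have t1: "of_nat (n choose d) * poly (S_KL d \<alpha> (int n - int d)) y = of_nat (n choose d) * ?L (n - d)"
    by (cases "d \<le> n") (simp_all add: S)
  have t2: "of_nat (n choose (d + 1)) * poly (S_KL d \<alpha> (int n - int d - 1)) y =
      of_nat (n choose (d + 1)) * ?L (n - d - 1)"
    using S[of "d + 1"] by (cases "d + 1 \<le> n") (simp_all add: algebra_simps)
  \<comment> \<open>Absorption at \<open>k = n - d - 1\<close> if \<open>d + 1 \<le> n\<close>;
    otherwise \<open>n choose (d + 1)\<close> makes both sides 0.\<close>
  have k: "(of_nat n - of_nat d - 1) * of_nat (n choose (d + 1)) * inverse (of_nat d + 1) * of_nat ((n - d - 2) choose d)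
      = of_nat (n choose (d + 1)) * complex_of_nat ((n - d - 1) choose (d + 1))"
  proof (cases "d + 1 \<le> n")
    case True
    then have e: "of_nat n - of_nat d - 1 = complex_of_nat (n - d - 1)" by (simp add: of_nat_diff)
    have "n - d - 1 - 1 = n - d - 2" by simp
    then show ?thesis
      using of_nat_choose_absorb[of "n - d - 1" d, where ?'a = complex] unfolding e by (simp add: ac_simps)
  qed simp
  have t3: "of_nat (n choose (d + 1)) * complex_of_nat ((n - d - 1) choose (d + 1)) * poly (S_KL d \<alpha> (int n - 2 * int d - 2)) y =
      of_nat (n choose (d + 1)) * of_nat ((n - d - 1) choose (d + 1)) * ?L (n - 2 * d - 2)"
  proof (cases "2 * d + 2 \<le> n")
    case True
    have "int n - 2 * int d - 2 = int n - int (2 * d + 2)" "n - 2 * d - 2 = n - (2 * d + 2)" by simp_all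
    then show ?thesis using S[OF True] by (simp only:)
  next
    case False
    then have "n - d - 1 < d + 1" by linarith
    then show ?thesis by (simp add: binomial_eq_0)
  qed
  have "int n + 1 = int (Suc n)" by simp
  then have "poly (S_KL d \<alpha> (int n + 1)) y = ?L (Suc n)"
    using S_KL_of_nat[OF assms] by (simp only: a_def)
  also have "\<dots> = (y + (a + of_nat n)\<^sup>2) * ?L n - inverse (of_nat d + 1) * (of_nat (n choose d) * ?L (n - d))
      + (2 * of_nat n + 2 * a - 1 - of_nat d) * (of_nat (n choose (d + 1)) * ?L (n - d - 1))
      + of_nat (n choose (d + 1)) * of_nat ((n - d - 1) choose (d + 1)) * ?L (n - 2 * d - 2)"
    unfolding KL_map_H_hat_rec by (simp add: algebra_simps)
  also have "?L n = poly (S_KL d \<alpha> (int n)) y"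
    using S[of 0] by simp
  also have "(a + of_nat n)\<^sup>2 = (complex_of_real \<alpha>)\<^sup>2 + (of_nat n + 1) * (of_nat n + 1 + 2 * complex_of_real \<alpha>)"
    by (simp add: a_def power2_eq_square algebra_simps)
  also have "2 * of_nat n + 2 * a - 1 - of_nat d = 2 * of_nat n + 2 * complex_of_real \<alpha> + 1 - of_nat d"
    by (simp add: a_def)
  finally show ?thesis
    unfolding t1[symmetric] t2[symmetric] t3[symmetric] k by (simp only: mult.assoc add.assoc)
qed

theorem lemma4p1:
  fixes \<alpha> :: real and d :: nat
  assumes "\<alpha> \<ge> 0" and "d \<ge> 1"
  shows "(\<forall>n. \<forall>\<tau>::real. \<tau> > 0 \<longrightarrow>
            poly (S_KL d \<alpha> (int n)) (complex_of_real (\<tau>\<^sup>2 / 4))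
              = KL \<alpha> (\<lambda>x. poly (H_hat d n) (complex_of_real x)) \<tau>)
       \<and> m_orthogonal (2 * d + 2) (\<lambda>n. S_KL d \<alpha> (int n))
       \<and> (\<forall>(n::nat) (\<tau>::complex).
            poly (S_KL d \<alpha> (int n + 1)) (\<tau>\<^sup>2 / 4)
            = (\<tau>\<^sup>2 / 4 + (complex_of_real \<alpha>)\<^sup>2
                 + (of_nat n + 1) * (of_nat n + 1 + 2 * complex_of_real \<alpha>))
                * poly (S_KL d \<alpha> (int n)) (\<tau>\<^sup>2 / 4)
              - inverse (of_nat d + 1) * of_nat (n choose d)
                * poly (S_KL d \<alpha> (int n - int d)) (\<tau>\<^sup>2 / 4)
              + (2 * of_nat n + 2 * complex_of_real \<alpha> + 1 - of_nat d) * of_nat (n choose (d + 1))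
                * poly (S_KL d \<alpha> (int n - int d - 1)) (\<tau>\<^sup>2 / 4)
              + (of_nat n - of_nat d - 1) * of_nat (n choose (d + 1))
                * inverse (of_nat d + 1) * of_nat ((n - d - 2) choose d)
                * poly (S_KL d \<alpha> (int n - 2 * int d - 2)) (\<tau>\<^sup>2 / 4))
       \<and> (\<forall>(n::nat) (\<tau>::complex). n \<le> d \<longrightarrow>
            poly (S_KL d \<alpha> (int n)) (\<tau>\<^sup>2 / 4)
            = pochhammer (complex_of_real \<alpha> + 1 - \<i> * \<tau> / 2) n
              * pochhammer (complex_of_real \<alpha> + 1 + \<i> * \<tau> / 2) n)
       \<and> (\<forall>(n::nat) (\<tau>::complex). \<tau> \<noteq> 0 \<longrightarrow>
            central_diff \<i> (\<lambda>t. poly (S_KL d \<alpha> (int n)) (t\<^sup>2 / 4)) \<tau>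
            = of_nat n / 2 * poly (S_KL d (\<alpha> + 1 / 2) (int n - 1)) (\<tau>\<^sup>2 / 4))"
proof (intro conjI allI impI)
  have S: "S_KL d \<alpha> (int n) = KL_map (of_real \<alpha> + 1) (H_hat d n)" for n
    using S_KL_of_nat[OF assms(1)] .
  show "poly (S_KL d \<alpha> (int n)) (complex_of_real (\<tau>\<^sup>2 / 4)) = KL \<alpha> (\<lambda>x. poly (H_hat d n) (complex_of_real x)) \<tau>"
    for n and \<tau> :: real
    unfolding S by (rule poly_KL_map_eq_KL[OF assms(1)])
  show "m_orthogonal (2 * d + 2) (\<lambda>n. S_KL d \<alpha> (int n))"
    unfolding S by (rule m_orthogonal_KL_map_H_hat[OF assms(2)])
  show "poly (S_KL d \<alpha> (int n)) (\<tau>\<^sup>2 / 4) = pochhammer (complex_of_real \<alpha> + 1 - \<i> * \<tau> / 2) n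
              * pochhammer (complex_of_real \<alpha> + 1 + \<i> * \<tau> / 2) n" if "n \<le> d" for n and \<tau> :: complex
    using that by (simp only: S H_hat_initial KL_map_monom smult_1_left poly_KL_basis)
  show "central_diff \<i> (\<lambda>t. poly (S_KL d \<alpha> (int n)) (t\<^sup>2 / 4)) \<tau>
            = of_nat n / 2 * poly (S_KL d (\<alpha> + 1 / 2) (int n - 1)) (\<tau>\<^sup>2 / 4)" if "\<tau> \<noteq> 0" for n and \<tau> :: complex
  proof (cases n)
    \<comment> \<open>\<open>S_KL\<close> is 0 at index -1, and the constant \<open>S_0\<close> has
      zero difference.\<close>
    case 0
    then show ?thesis unfolding S by (simp add: S_KL_def H_hat_initial KL_map_def KL_basis_def central_diff_def)
  next
    case (Suc m)
    \<comment> \<open>Raising \<alpha> by 1/2 raises \<open>a = \<alpha> + 1\<close> by 1/2, the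
      shift that the central difference produces.\<close>
    have "S_KL d (\<alpha> + 1 / 2) (int n - 1) = KL_map (of_real \<alpha> + 1 + 1 / 2) (H_hat d m)"
      using S_KL_of_nat[of "\<alpha> + 1 / 2" d m] assms(1) Suc by (simp add: add_ac)
    then show ?thesis
      unfolding S central_diff_KL_map[OF that] unfolding Suc pderiv_H_hat_Suc KL_map_smult by simp
  qed
qed (rule S_KL_rec[OF assms(1)])

end
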